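(* Let $\mathcal{P}\subset\mathbb{R}^m$ be a nonempty convex polyhedron with affine hull $\mathcal{A}(\mathcal{P})$, and let $p\in \mathcal{A}(\mathcal{P})\setminus\mathcal{P}$. A point $e\in\mathcal{P}$ is the nearest point of $\mathcal{P}$ to $p$ if and only if $e$ is $p$-visible and, for every proper face $F$ of $\mathcal{P}$ with $e\in F$, there is no escape from $e$ toward $p$ along $F$.
   Context: All distances and orthogonal projections are Euclidean. A polyhedron is the solution set of a finite system of (non-strict) linear inequalities and equalities. $\mathcal{A}(X)$ denotes the affine hull of a set $X$. Faces are nonempty; a proper face of $\mathcal{P}$ is a face different from $\mathcal{P}$. A point $e\in\mathcal{P}$ is called $p$-visible (for $p\notin\mathcal{P}$) if there are no points of $\mathcal{P}$ on the open segment $(e,p)$. Escape: let $e\in F$ where $F$ is a proper face of $\mathcal{P}$, and let $p\notin\mathcal{P}$. Let $\pi_F$ be the orthogonal projection of $p$ onto $\mathcal{A}(F)$. An escape from $e$ toward $p$ along $F$ is a point $e'\neq e$ such that $e'=e+t_0(\pi_F-e)$, where $t_0\in(0,1]$ is largest such that $e+t_0(\pi_F-e)\in\mathcal{P}$. (Thus there is no escape along $F$ if $\pi_F=e$ or if $e+t(\pi_F-e)\notin\mathcal{P}$ for all $t\in(0,1]$.) *)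

theory Defs
  imports "HOL-Analysis.Analysis"
begin

text \<open>
  Polyhedra and faces are those of \<^theory>\<open>HOL-Analysis.Polytope\<close>. There the empty set counts
  as a face, so it has to be excluded explicitly.
\<close>

definition proper_face :: "'a::euclidean_space set \<Rightarrow> 'a set \<Rightarrow> bool" where
  "proper_face P F \<longleftrightarrow> F face_of P \<and> F \<noteq> {} \<and> F \<noteq> P"

text \<open>
  The description is meaningful for nonempty affine \<open>A\<close>, where the foot of the perpendicular
  exists and is unique.
\<close>

definition orth_proj :: "'a::euclidean_space set \<Rightarrow> 'a \<Rightarrow> 'a" where
  "orth_proj A p = (THE q. q \<in> A \<and> (\<forall>x\<in>A. orthogonal (p - q) (x - q)))"

definition visible :: "'a::euclidean_space set \<Rightarrow> 'a \<Rightarrow> 'a \<Rightarrow> bool" where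
  "visible P p e \<longleftrightarrow> e \<in> P \<and> open_segment e p \<inter> P = {}"

text \<open>
  \<open>e'\<close> is an escape from \<open>e\<close> toward \<open>p\<close> along \<open>F\<close>, intended for \<open>e \<in> F\<close>, \<open>F\<close> a proper face of
  \<open>P\<close> and \<open>p \<notin> P\<close>.
\<close>

definition is_escape ::
  "'a::euclidean_space set \<Rightarrow> 'a \<Rightarrow> 'a set \<Rightarrow> 'a \<Rightarrow> 'a \<Rightarrow> bool" where
  "is_escape P p F e e' \<longleftrightarrow>
     (let \<pi> = orth_proj (affine hull F) p in
        e' \<noteq> e \<and>
        (\<exists>t0. t0 \<in> {0<..1} \<and> e + t0 *\<^sub>R (\<pi> - e) \<in> P \<and>
              (\<forall>t\<in>{0<..1}. e + t *\<^sub>R (\<pi> - e) \<in> P \<longrightarrow> t \<le> t0) \<and>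
              e' = e + t0 *\<^sub>R (\<pi> - e)))"

end

theory Submission
  imports Defs
begin

text \<open>
  If \<open>e\<close> is nearest, Pythagoras shows that any escape would be strictly nearer to \<open>p\<close>, and so would
  any point of \<open>P\<close> on the open segment.

  Conversely, let \<open>K\<close> be the cone cut out by the constraints of \<open>P\<close> active at \<open>e\<close> and let \<open>u\<close> be
  the point of \<open>K\<close> nearest to \<open>p - e\<close>. If \<open>u = 0\<close>, then \<open>e\<close> is nearest. Otherwise, the
  constraints of \<open>K\<close> active at \<open>u\<close>, taken as equalities, cut out a face \<open>F\<close> of \<open>P\<close> through \<open>e\<close> on
  whose affine hull \<open>p\<close> projects to \<open>e + u\<close>, so there is an escape along \<open>F\<close>. Were \<open>F\<close> equal
  to \<open>P\<close>, then \<open>p \<in> affine hull P\<close> would force \<open>p - e = u \<in> K\<close>, against visibility.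
\<close>

section \<open>Orthogonal projection onto affine sets\<close>

lemma orth_proj_eqI:
  assumes "q \<in> A" and "\<And>x. x \<in> A \<Longrightarrow> (p - q) \<bullet> (x - q) = 0"
  shows "orth_proj A p = q"
  unfolding orth_proj_def
proof (rule the_equality)
  show "q \<in> A \<and> (\<forall>x\<in>A. orthogonal (p - q) (x - q))"
    using assms by (simp add: orthogonal_def)
next
  fix r assume r: "r \<in> A \<and> (\<forall>x\<in>A. orthogonal (p - r) (x - r))"
  \<comment> \<open>The squared distance of two candidate feet splits into two terms, and the
    orthogonality condition of each foot kills one of them.\<close>
  have "(r - q) \<bullet> (r - q) = (p - q) \<bullet> (r - q) + (p - r) \<bullet> (q - r)"
    by (simp add: inner_diff inner_commute)
  also have "\<dots> = 0"
    using r assms by (simp add: orthogonal_def)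
  finally show "r = q" by simp
qed

text \<open>The foot exists because the nearest point of \<open>A\<close> meets the orthogonality
  condition.\<close>

lemma orth_proj_affine:
  assumes "affine A" "A \<noteq> {}"
  shows "orth_proj A p \<in> A" and "x \<in> A \<Longrightarrow> (p - orth_proj A p) \<bullet> (x - orth_proj A p) = 0"
proof -
  let ?q = "closest_point A p"
  have A: "convex A" "closed A"
    using assms by (auto simp: affine_imp_convex affine_closed)
  have q: "?q \<in> A"
    using A assms closest_point_in_set by blast
  have orth: "(p - ?q) \<bullet> (x - ?q) = 0" if "x \<in> A" for x
  proof -
    \<comment> \<open>The reflection of \<open>x\<close> in \<open>?q\<close> stays in
      \<open>A\<close>. The obtuse-angle inequality at \<open>x\<close> and at its reflection gives
      both signs, hence equality.\<close>
    have "2 *\<^sub>R ?q + (-1) *\<^sub>R x \<in> A"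
      by (rule mem_affine) (use assms(1) q that in auto)
    from closest_point_dot[OF A this, of p] closest_point_dot[OF A that, of p]
    show ?thesis by (simp add: inner_diff inner_add scaleR_2)
  qed
  have "orth_proj A p = ?q"
    using q orth by (rule orth_proj_eqI)
  then show "orth_proj A p \<in> A" "x \<in> A \<Longrightarrow> (p - orth_proj A p) \<bullet> (x - orth_proj A p) = 0"
    using q orth by auto
qed

section \<open>Escapes and visibility\<close>

lemma escape_closer:
  assumes "is_escape P p F e e'" "e \<in> F"
  shows "e' \<in> P" "dist p e' < dist p e"
proof -
  define q where "q = orth_proj (affine hull F) p"
  obtain t where t: "0 < t" "t \<le> 1" "e' = e + t *\<^sub>R (q - e)" "e' \<noteq> e" and "e' \<in> P"
    using assms(1) unfolding is_escape_def q_def Let_def by auto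
  show "e' \<in> P" by fact
  have e: "e \<in> affine hull F"
    using assms(2) by (simp add: hull_inc)
  have orth: "(p - q) \<bullet> (e - q) = 0"
    unfolding q_def using e by (intro orth_proj_affine) auto
  \<comment> \<open>Measured from \<open>q\<close>, the value \<open>s = 1\<close> is
    \<open>e\<close> and \<open>s = 1 - t\<close> is \<open>e'\<close>, so the escape shrinks only
    the component along the hull.\<close>
  have *: "(norm (p - (q + s *\<^sub>R (e - q))))\<^sup>2 = (norm (p - q))\<^sup>2 + s\<^sup>2 * (norm (e - q))\<^sup>2" for s
  proof -
    have "orthogonal (p - q) (- (s *\<^sub>R (e - q)))"
      using orth by (simp add: orthogonal_def)
    from norm_add_Pythagorean[OF this] show ?thesis
      by (simp add: power_mult_distrib diff_diff_eq)
  qed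
  have "e' = q + (1 - t) *\<^sub>R (e - q)"
    using t(3) by (simp add: algebra_simps)
  then have "(norm (p - e'))\<^sup>2 = (norm (p - q))\<^sup>2 + (1 - t)\<^sup>2 * (norm (e - q))\<^sup>2"
    using *[of "1 - t"] by simp
  moreover have "(1 - t)\<^sup>2 < 1"
    using t by (simp add: power_less_one_iff)
  moreover have "(norm (e - q))\<^sup>2 > 0"
    using t by auto
  moreover have "(norm (p - e))\<^sup>2 = (norm (p - q))\<^sup>2 + (norm (e - q))\<^sup>2"
    using *[of 1] by simp
  ultimately have "(norm (p - e'))\<^sup>2 < (norm (p - e))\<^sup>2"
    by simp
  then show "dist p e' < dist p e"
    unfolding dist_norm by (rule power_less_imp_less_base) simp
qed

lemma escape_exists:
  assumes "closed P" and q: "orth_proj (affine hull F) p = q" "q \<noteq> e"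
    and s: "0 < s" "s \<le> 1" "e + s *\<^sub>R (q - e) \<in> P"
  shows "\<exists>e'. is_escape P p F e e'"
proof -
  \<comment> \<open>Including 0 makes the parameter set compact; the maximum is still positive
    because it is at least \<open>s\<close>.\<close>
  define T where "T = {0..1} \<inter> (\<lambda>t. e + t *\<^sub>R (q - e)) -` P"
  have "compact T"
    unfolding T_def by (intro compact_Int_closed continuous_closed_vimage assms) (auto intro!: continuous_intros)
  moreover have sT: "s \<in> T"
    using s by (simp add: T_def)
  ultimately obtain t where t: "t \<in> T" "\<And>r. r \<in> T \<Longrightarrow> r \<le> t"
    using compact_attains_sup[of T] by blast
  have "0 < t"
    using t(2)[OF sT] s by linarith
  then have "is_escape P p F e (e + t *\<^sub>R (q - e))"
    using t q unfolding is_escape_def Let_def T_def by auto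
  then show ?thesis ..
qed

lemma closest_point_imp_visible:
  assumes P: "convex P" "closed P" and e: "e \<in> P" "e = closest_point P p"
  shows "visible P p e"
proof -
  have False if x: "x \<in> open_segment e p" "x \<in> P" for x
  proof -
    have "dist p e \<le> dist p x"
      using closest_point_le[OF P(2) x(2)] e by auto
    then show False
      using dist_decreases_open_segment[OF x(1), of p]
        dist_in_open_segment[OF x(1)] by (simp add: dist_commute)
  qed
  then show ?thesis
    using e unfolding visible_def by blast
qed

section \<open>Finite systems of linear constraints\<close>

lemma strict_constraints_stable:
  fixes \<alpha> \<beta> \<gamma> :: "'i \<Rightarrow> real"
  assumes "finite I" "\<And>i. i \<in> I \<Longrightarrow> \<alpha> i < \<beta> i"
  obtains \<delta> where "0 < \<delta>" "\<delta> \<le> 1" "\<And>i s. i \<in> I \<Longrightarrow> \<bar>s\<bar> \<le> \<delta> \<Longrightarrow> \<alpha> i + s * \<gamma> i < \<beta> i"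
proof -
  \<comment> \<open>Each strict inequality survives near 0 by continuity; finiteness of
    \<open>I\<close> gives one neighbourhood for all.\<close>
  have "\<forall>\<^sub>F s in nhds 0. \<forall>i\<in>I. \<alpha> i + s * \<gamma> i < \<beta> i"
  proof (intro eventually_ball_finite ballI assms(1))
    fix i assume "i \<in> I"
    have "((\<lambda>s. \<alpha> i + s * \<gamma> i) \<longlongrightarrow> \<alpha> i + 0 * \<gamma> i) (nhds 0)"
      by (intro tendsto_intros filterlim_ident)
    then show "\<forall>\<^sub>F s in nhds 0. \<alpha> i + s * \<gamma> i < \<beta> i"
      using assms(2)[OF \<open>i \<in> I\<close>] by (auto dest: order_tendstoD(2))
  qed
  then obtain d where d: "d > 0" "\<And>s i. \<bar>s\<bar> < d \<Longrightarrow> i \<in> I \<Longrightarrow> \<alpha> i + s * \<gamma> i < \<beta> i"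
    unfolding eventually_nhds_metric by (auto simp: dist_real_def)
  show thesis
    \<comment> \<open>Halving \<open>d\<close> allows a non-strict bound on \<bar>s\<bar>; the cap 1
      matches the range of escape parameters.\<close>
    by (rule that[of "min 1 (d/2)"]) (use d in auto)
qed

text \<open>Each half-space serves as the index of its own inequality.\<close>

lemma polyhedron_constraints:
  assumes "polyhedron P"
  obtains H and a :: "'a::euclidean_space set \<Rightarrow> 'a" and b where "finite H" "P = {x. \<forall>h\<in>H. a h \<bullet> x \<le> b h}"
proof -
  obtain H where H: "finite H" "P = \<Inter>H" "\<forall>h\<in>H. \<exists>a b. a \<noteq> 0 \<and> h = {x. a \<bullet> x \<le> b}"
    using assms unfolding polyhedron_def by blast
  then obtain a b where "\<And>h. h \<in> H \<Longrightarrow> h = {x. a h \<bullet> x \<le> b h}"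
    by metis
  with H(2) have "P = {x. \<forall>h\<in>H. a h \<bullet> x \<le> b h}"
    by (auto; blast)
  with H(1) show thesis ..
qed

text \<open>Each constraint in \<open>J\<close> is valid on \<open>P\<close>, so its equality set
  cuts out a face, and intersections of faces are faces.\<close>

lemma face_of_tight_constraints:
  assumes "P = {x. \<forall>h\<in>H. a h \<bullet> x \<le> b h}" "J \<subseteq> H"
  shows "{x \<in> P. \<forall>h\<in>J. a h \<bullet> x = b h} face_of P"
proof -
  let ?X = "\<lambda>h. P \<inter> {x. a h \<bullet> x = b h}"
  have P: "convex P"
    unfolding assms(1) by (auto simp: convex_alt inner_add intro!: convex_bound_le)
  \<comment> \<open>Intersecting with \<open>P\<close> covers empty \<open>J\<close>, where the
    intersection alone would be the whole space.\<close>
  have "(P \<inter> \<Inter>(?X ` J)) face_of P"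
  proof (cases "J = {}")
    case True
    then show ?thesis using P by (simp add: face_of_refl)
  next
    case False
    have "?X h face_of P" if "h \<in> J" for h
      using that assms P by (intro face_of_Int_supporting_hyperplane_le) auto
    then have "\<Inter>(?X ` J) face_of P"
      using False by (intro face_of_Inter) auto
    then show ?thesis
      using P by (simp add: face_of_Int face_of_refl)
  qed
  also have "P \<inter> \<Inter>(?X ` J) = {x \<in> P. \<forall>h\<in>J. a h \<bullet> x = b h}"
    by auto
  finally show ?thesis .
qed

section \<open>An escape from a visible point that is not nearest\<close>

lemma exists_escape_if_not_closest:
  fixes P :: "'a::euclidean_space set"
  assumes poly: "polyhedron P" and p: "p \<in> affine hull P"
    and vis: "visible P p e" "p \<noteq> e" and ne: "e \<noteq> closest_point P p"
  obtains F e' where "proper_face P F" "e \<in> F" "is_escape P p F e e'"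
proof -
  obtain H and a :: "'a set \<Rightarrow> 'a" and b
    where H: "finite H" and P: "P = {x. \<forall>h\<in>H. a h \<bullet> x \<le> b h}"
    using polyhedron_constraints[OF poly] .
  have e: "e \<in> P"
    using vis by (simp add: visible_def)
  define I where "I = {h \<in> H. a h \<bullet> e = b h}"
  define K where "K = {v. \<forall>h\<in>I. a h \<bullet> v \<le> 0}"
  \<comment> \<open>Directions in \<open>K\<close> never violate active constraints, and the
    inactive ones have slack for a short step.\<close>
  have feasible: "\<exists>s. 0 < s \<and> s \<le> 1 \<and> e + s *\<^sub>R v \<in> P" if "v \<in> K" for v
  proof -
    have "finite (H - I)" "\<And>h. h \<in> H - I \<Longrightarrow> a h \<bullet> e < b h"
      using H e by (auto simp: I_def P order_less_le)
    then obtain s where s: "0 < s" "s \<le> 1"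
      "\<And>h r. h \<in> H - I \<Longrightarrow> \<bar>r\<bar> \<le> s \<Longrightarrow> a h \<bullet> e + r * (a h \<bullet> v) < b h"
      using strict_constraints_stable[of "H - I" "\<lambda>h. a h \<bullet> e" b "\<lambda>h. a h \<bullet> v"] by blast
    have "a h \<bullet> (e + s *\<^sub>R v) \<le> b h" if "h \<in> H" for h
    proof (cases "h \<in> I")
      case True
      then show ?thesis
        using \<open>v \<in> K\<close> s(1) by (auto simp: I_def K_def inner_add mult_le_0_iff)
    next
      case False
      then show ?thesis
        using s(3)[of h s] s(1) that by (simp add: inner_add)
    qed
    then show ?thesis using s by (auto simp: P)
  qed
  have "K = (\<Inter>h\<in>I. {v. a h \<bullet> v \<le> 0})"
    by (auto simp: K_def)
  then have K: "convex K" "closed K" "0 \<in> K"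
    by (auto simp: convex_INT convex_halfspace_le closed_INT closed_halfspace_le)
  define d where "d = p - e"
  define u where "u = closest_point K d"
  have uK: "u \<in> K"
    unfolding u_def using K closest_point_in_set by blast
  have dot: "(d - u) \<bullet> (v - u) \<le> 0" if "v \<in> K" for v
    unfolding u_def by (rule closest_point_dot) (use K that in auto)
  have "u \<noteq> 0"
  proof
    assume "u = 0"
    have "dist p e \<le> dist p x" if "x \<in> P" for x
    proof -
      have "x - e \<in> K"
        using that by (auto simp: P K_def I_def inner_diff)
      from dot[OF this] have "(p - e) \<bullet> (x - e) \<le> 0"
        by (simp add: \<open>u = 0\<close> d_def)
      then have "(p - e) \<bullet> (p - e) \<le> (p - x) \<bullet> (p - x)"
        using inner_ge_zero[of "x - e"] by (simp add: inner_diff inner_commute)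
      then show ?thesis
        by (simp add: dist_norm norm_le)
    qed
    then have "e = closest_point P p"
      using poly e by (intro closest_point_unique) (auto simp: polyhedron_imp_convex polyhedron_imp_closed)
    with ne show False by simp
  qed
  define J where "J = {h \<in> I. a h \<bullet> u = 0}"
  define V where "V = {v. \<forall>h\<in>J. a h \<bullet> v = 0}"
  \<comment> \<open>Constraints in \<open>J\<close> stay tight along \<open>v\<close> and those in
    \<open>I - J\<close> have slack at \<open>u\<close>, so \<open>u + s v\<close> and
    \<open>u - s v\<close> both lie in \<open>K\<close>; the two inequalities from
    \<open>dot\<close> force equality.\<close>
  have perp: "(d - u) \<bullet> v = 0" if "v \<in> V" for v
  proof -
    have "finite (I - J)" "\<And>h. h \<in> I - J \<Longrightarrow> a h \<bullet> u < 0"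
      using H uK by (auto simp: I_def J_def K_def order_less_le)
    then obtain s where s: "0 < s" "s \<le> 1"
      "\<And>h r. h \<in> I - J \<Longrightarrow> \<bar>r\<bar> \<le> s \<Longrightarrow> a h \<bullet> u + r * (a h \<bullet> v) < 0"
      using strict_constraints_stable[of "I - J" "\<lambda>h. a h \<bullet> u" "\<lambda>_. 0" "\<lambda>h. a h \<bullet> v"] by blast
    have "u + r *\<^sub>R v \<in> K" if "\<bar>r\<bar> \<le> s" for r
    proof -
      have "a h \<bullet> (u + r *\<^sub>R v) \<le> 0" if "h \<in> I" for h
      proof (cases "h \<in> J")
        case True
        then show ?thesis
          using \<open>v \<in> V\<close> by (simp add: J_def V_def inner_add)
      next
        case False
        then show ?thesis
          using s(3)[of h r] \<open>\<bar>r\<bar> \<le> s\<close> that by (simp add: inner_add)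
      qed
      then show ?thesis by (simp add: K_def)
    qed
    from dot[OF this[of s]] dot[OF this[of "- s"]] s(1) show ?thesis
      by (simp add: mult_le_0_iff zero_le_mult_iff)
  qed
  have uV: "u \<in> V"
    by (simp add: V_def J_def)
  define F where "F = {x \<in> P. \<forall>h\<in>J. a h \<bullet> x = b h}"
  have eF: "e \<in> F"
    using e by (auto simp: F_def J_def I_def)
  have hull: "x - e \<in> V" if "x \<in> affine hull F" for x
  proof -
    have "affine {x. x - e \<in> V}"
      unfolding affine_alt V_def by (simp add: inner_diff inner_add algebra_simps)
    moreover have "F \<subseteq> {x. x - e \<in> V}"
      using eF by (auto simp: F_def V_def inner_diff)
    ultimately show ?thesis
      using hull_minimal[of F _ affine] that by blast
  qed
  obtain s where s: "0 < s" "s \<le> 1" "e + s *\<^sub>R u \<in> P"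
    using feasible[OF uK] by blast
  have "e + s *\<^sub>R u \<in> F"
    using s eF uV by (simp add: F_def V_def inner_add)
  \<comment> \<open>Rescaling by \<open>1 / s\<close> along the line through two points of
    \<open>F\<close> reaches \<open>e + u\<close>, even if that point is outside
    \<open>P\<close>.\<close>
  then have "(1 - 1 / s) *\<^sub>R e + (1 / s) *\<^sub>R (e + s *\<^sub>R u) \<in> affine hull F"
    using eF by (intro mem_affine affine_affine_hull hull_inc) auto
  then have "e + u \<in> affine hull F"
    using s(1) by (simp add: algebra_simps)
  moreover have "(p - (e + u)) \<bullet> (x - (e + u)) = 0" if "x \<in> affine hull F" for x
    using perp[OF hull[OF that]] perp[OF uV] by (simp add: d_def inner_diff inner_add algebra_simps)
  ultimately have proj: "orth_proj (affine hull F) p = e + u"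
    by (rule orth_proj_eqI)
  have "\<exists>e'. is_escape P p F e e'"
    by (rule escape_exists[OF _ proj]) (use s \<open>u \<noteq> 0\<close> poly polyhedron_imp_closed in auto)
  moreover have "F \<noteq> P"
  proof
    assume "F = P"
    then have "d \<in> V"
      using hull p by (simp add: d_def)
    \<comment> \<open>Both \<open>d\<close> and \<open>u\<close> lie in \<open>V\<close>, so
      \<open>d - u\<close> is orthogonal to itself and \<open>d = u\<close>.\<close>
    then have "(d - u) \<bullet> (d - u) = 0"
      using perp[OF uV] perp[of d] by (simp add: inner_diff_right)
    then have "d \<in> K"
      using uK by simp
    then obtain r where r: "0 < r" "r \<le> 1" "e + r *\<^sub>R d \<in> P"
      using feasible by blast
    \<comment> \<open>For \<open>r = 1\<close> the point reached is the endpoint \<open>p\<close>;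
      the midpoint with \<open>e\<close> is strictly inside the segment and lies in \<open>P\<close>
      by convexity.\<close>
    have "e + (r/2) *\<^sub>R d = (1/2) *\<^sub>R e + (1/2) *\<^sub>R (e + r *\<^sub>R d)"
      by (simp add: algebra_simps flip: scaleR_add_left)
    also have "\<dots> \<in> P"
      using polyhedron_imp_convex[OF poly] e r(3) by (intro convexD) auto
    finally have "e + (r/2) *\<^sub>R d \<in> P" .
    moreover have "e + (r/2) *\<^sub>R d \<in> open_segment e p"
      unfolding in_segment using vis(2) r(1,2)
      by (intro conjI exI[of _ "r/2"]) (auto simp: d_def algebra_simps)
    ultimately show False
      using vis(1) by (auto simp: visible_def)
  qed
  moreover have "F face_of P"
    unfolding F_def by (rule face_of_tight_constraints[OF P]) (auto simp: J_def I_def)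
  ultimately show thesis
    using that eF unfolding proper_face_def by blast
qed

theorem theorem1p1:
  fixes P :: "(real ^ 'm) set" and p e :: "real ^ 'm"
  assumes "polyhedron P" and "P \<noteq> {}"
    and "p \<in> affine hull P - P"
    and "e \<in> P"
  shows "e = closest_point P p \<longleftrightarrow>
    visible P p e \<and>
    (\<forall>F. proper_face P F \<and> e \<in> F \<longrightarrow> \<not> (\<exists>e'. is_escape P p F e e'))"
proof (intro iffI conjI allI impI notI)
  assume e: "e = closest_point P p"
  have P: "convex P" "closed P"
    using assms(1) by (simp_all add: polyhedron_imp_convex polyhedron_imp_closed)
  show "visible P p e"
    using P assms(4) e by (rule closest_point_imp_visible)
  fix F assume "proper_face P F \<and> e \<in> F" and "\<exists>e'. is_escape P p F e e'"
  then obtain e' where "e' \<in> P" "dist p e' < dist p e"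
    using escape_closer by blast
  then show False
    using closest_point_le[OF P(2), of e' p] e by simp
next
  assume R: "visible P p e \<and>
    (\<forall>F. proper_face P F \<and> e \<in> F \<longrightarrow> \<not> (\<exists>e'. is_escape P p F e e'))"
  have "p \<in> affine hull P" "p \<noteq> e"
    using assms by auto
  with R assms(1) show "e = closest_point P p"
    by (meson exists_escape_if_not_closest)
qed

end
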